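(* Let $\eta_l<\eta_r$ be real numbers and let $F\in C^3(\mathbb{R})$ satisfy $F'(\eta_l)=F'(\eta_r)=0$, $F''(\eta_l)>0$ and $F''(\eta_r)>0$. Let $c\in\mathbb{R}$ and let $\eta\in C^2(\mathbb{R})$ be an increasing function with $\eta'>0$ such that $$-|\partial_x|\eta(x)+c\,\eta'(x)=F'(\eta(x))\quad\text{for all }x\in\mathbb{R},\qquad \lim_{x\to-\infty}\eta(x)=\eta_l,\qquad \lim_{x\to+\infty}\eta(x)=\eta_r.$$ Assume moreover that there exist constants $B>A>0$ such that $A|x|^{-2}\le \eta'(x)\le B|x|^{-2}$ for all $|x|\ge 1$. Then $$\eta(x)-\eta_r \underset{x\to+\infty}{\sim} \frac{\eta_l-\eta_r}{\pi F''(\eta_r)}\,x^{-1}\qquad\text{and}\qquad \eta(x)-\eta_l \underset{x\to-\infty}{\sim} \frac{\eta_l-\eta_r}{\pi F''(\eta_l)}\,x^{-1}.$$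
   Context: The operator $|\partial_x|$ (also written $(-\Delta)^{1/2}$) is the operator with Fourier symbol $|k|$. For $u\in L^\infty(\mathbb{R})\cap C^2(\mathbb{R})$ it is given by $$|\partial_x|u(x)=-\frac1\pi\int_0^{+\infty}\frac{u(x+y)-2u(x)+u(x-y)}{y^2}\,dy .$$ The notation $f(x)\sim g(x)$ as $x\to\pm\infty$ means $f(x)/g(x)\to1$. *)

theory Defs
  imports "HOL-Analysis.Analysis" "HOL-Library.Landau_Symbols"
begin

definition C_k_real :: "nat \<Rightarrow> (real \<Rightarrow> real) \<Rightarrow> bool" where
  "C_k_real k f \<longleftrightarrow>
     (\<forall>i<k. \<forall>x. (deriv ^^ i) f differentiable (at x)) \<and> continuous_on UNIV ((deriv ^^ k) f)"

(* The operator with Fourier symbol abs k, on bounded C^2 functions. For such u the integrand is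
   absolutely integrable: it is bounded near 0 because u is C^2, and it is O(y^(-2)) at infinity
   because u is bounded. Hence a Lebesgue integral suffices, and no principal value is needed.
   For other u the value carries no meaning (a non-integrable integrand gives 0). *)
definition half_laplacian :: "(real \<Rightarrow> real) \<Rightarrow> real \<Rightarrow> real" where
  "half_laplacian u x =
     - (1 / pi) * (LBINT y:{0<..}. (u (x + y) - 2 * u x + u (x - y)) / y\<^sup>2)"

end

theory Submission
  imports Defs "HOL-Real_Asymp.Real_Asymp"
begin

text \<open>
  Split the integral defining the half Laplacian of \<open>\<eta>\<close> at \<open>y = 1\<close>. Substituting \<open>y = t s\<close> and using
  \<open>\<eta>' = O(x\<^sup>-\<^sup>2)\<close> for domination, \<open>t\<close> times the far part tends to \<open>\<eta>\<^sub>l - \<eta>\<^sub>r\<close> as \<open>t \<rightarrow> \<infinity>\<close>. The near part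
  involves \<open>\<eta>''\<close>, for which no decay is known; but it is the derivative in \<open>x\<close> of a weighted mean of \<open>\<eta>'\<close>,
  so by the mean value theorem every interval \<open>(x, x + 1)\<close> contains a point \<open>t\<close> where it is
  \<open>O(x\<^sup>-\<^sup>2)\<close>. The equation at \<open>t\<close> yields \<open>t F'(\<eta>(t)) \<rightarrow> (\<eta>\<^sub>l - \<eta>\<^sub>r) / \<pi>\<close>, linearising \<open>F'\<close> at \<open>\<eta>\<^sub>r\<close> yields
  the limit of \<open>t (\<eta>(t) - \<eta>\<^sub>r)\<close>, and replacing \<open>t\<close> by \<open>x\<close> costs only \<open>O(1/x)\<close>. The behaviour at
  \<open>-\<infinity>\<close> follows by applying this to \<open>x \<mapsto> -\<eta>(-x)\<close>.
\<close>

section \<open>Second differences as weighted means of the second derivative\<close>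

definition second_diff :: "(real \<Rightarrow> real) \<Rightarrow> real \<Rightarrow> real \<Rightarrow> real" where
  "second_diff u x y = u (x + y) - 2 * u x + u (x - y)"

text \<open>The average of \<open>g\<close> over the interval of radius \<open>\<bar>y\<bar>\<close>
  around \<open>x\<close>, with a tent-shaped weight of total mass 1. Unlike a difference quotient
  it is meaningful at \<open>y = 0\<close>, where it equals \<open>g x\<close>.\<close>

definition tent_mean :: "(real \<Rightarrow> real) \<Rightarrow> real \<Rightarrow> real \<Rightarrow> real" where
  "tent_mean g x y = integral {0..1} (\<lambda>s. (1 - s) * (g (x + s * y) + g (x - s * y)))"

lemma continuous_on_tent_mean:
  assumes "continuous_on UNIV g"
  shows "continuous_on UNIV (\<lambda>(x, y). tent_mean g x y)"
proof -
  have "continuous_on UNIV (\<lambda>z. integral (cbox 0 1)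
      (\<lambda>s. (1 - s) * (g (fst z + s * snd z) + g (fst z - s * snd z))))"
    unfolding split_beta
    by (intro integral_continuous_on_param)
       (auto simp: split_beta intro!: continuous_intros continuous_on_compose2[OF assms])
  then show ?thesis
    by (simp add: tent_mean_def split_beta)
qed

lemma continuous_on_tent_mean_right:
  assumes "continuous_on UNIV g"
  shows "continuous_on S (tent_mean g x)"
proof -
  have "continuous_on S (\<lambda>y. (x, y))"
    by (intro continuous_intros)
  then show ?thesis
    using continuous_on_compose2[OF continuous_on_tent_mean[OF assms]] by fastforce
qed

text \<open>Used with \<open>u'\<close> for \<open>g\<close>: it exhibits the tent mean of
  \<open>u''\<close> as the derivative in \<open>x\<close> of a quantity controlled by
  \<open>u'\<close> alone.\<close>

lemma has_real_derivative_tent_mean: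
  assumes g: "\<And>x. (g has_real_derivative g' x) (at x)"
    and cont: "continuous_on UNIV g'"
  shows "((\<lambda>x. tent_mean g x y) has_real_derivative tent_mean g' x y) (at x)"
proof -
  have g_cont: "continuous_on UNIV g"
    using g by (intro continuous_at_imp_continuous_on) (auto intro: DERIV_isCont)
  have "((\<lambda>x. integral (cbox 0 1) (\<lambda>s. (1 - s) * (g (x + s * y) + g (x - s * y))))
      has_real_derivative
      integral (cbox 0 1) (\<lambda>s. (1 - s) * (g' (x + s * y) + g' (x - s * y)))) (at x within UNIV)"
  proof (rule leibniz_rule_field_derivative)
    show "((\<lambda>x. (1 - s) * (g (x + s * y) + g (x - s * y))) has_real_derivative
        (1 - s) * (g' (x + s * y) + g' (x - s * y))) (at x within UNIV)" for x s
      by (auto intro!: derivative_eq_intros DERIV_chain'[OF _ g])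
    show "(\<lambda>s. (1 - s) * (g (x + s * y) + g (x - s * y))) integrable_on cbox 0 1" for x
      by (intro integrable_continuous)
         (auto intro!: continuous_intros continuous_on_compose2[OF g_cont])
  qed (auto simp: split_beta intro!: continuous_intros continuous_on_compose2[OF cont])
  then show ?thesis
    by (simp add: tent_mean_def)
qed

text \<open>Taylor's formula with integral remainder, added up for the increments \<open>y\<close>
  and \<open>-y\<close>; the first-order terms cancel.\<close>

lemma second_diff_eq_tent_mean:
  assumes u: "\<And>x. (u has_real_derivative u' x) (at x)"
    and u': "\<And>x. (u' has_real_derivative u'' x) (at x)"
  shows "second_diff u x y = y\<^sup>2 * tent_mean u'' x y"
proof -
  \<comment> \<open>a primitive in \<open>s\<close> of the integrand defining \<open>y\<^sup>2 * tent_mean u'' x y\<close>\<close>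
  define P where "P s = (1 - s) * y * (u' (x + s * y) - u' (x - s * y))
      + u (x + s * y) + u (x - s * y)" for s
  have "((\<lambda>s. y\<^sup>2 * ((1 - s) * (u'' (x + s * y) + u'' (x - s * y)))) has_integral
      P 1 - P 0) {0..1}"
    unfolding P_def
    by (intro fundamental_theorem_of_calculus)
       (auto simp: has_real_derivative_iff_has_vector_derivative[symmetric] power2_eq_square
         algebra_simps
         intro!: derivative_eq_intros DERIV_chain'[OF _ u] DERIV_chain'[OF _ u'])
  then have "integral {0..1} (\<lambda>s. y\<^sup>2 * ((1 - s) * (u'' (x + s * y) + u'' (x - s * y)))) = P 1 - P 0"
    by (rule integral_unique)
  then show ?thesis
    by (simp add: tent_mean_def P_def second_diff_def)
qed

lemma abs_tent_mean_le:
  assumes "continuous_on UNIV g"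
    and bound: "\<And>z. \<bar>z - x\<bar> \<le> \<bar>y\<bar> \<Longrightarrow> \<bar>g z\<bar> \<le> K"
  shows "\<bar>tent_mean g x y\<bar> \<le> 2 * K"
proof -
  \<comment> \<open>The weight \<open>1 - s\<close> is bounded by 1 rather than integrated, which
    gives \<open>2 * K\<close> where the sharp constant is \<open>K\<close>.\<close>
  have "norm (integral {0..1} (\<lambda>s. (1 - s) * (g (x + s * y) + g (x - s * y)))) \<le> 2 * K * (1 - 0)"
  proof (rule integral_bound)
    show "continuous_on {0..1} (\<lambda>s. (1 - s) * (g (x + s * y) + g (x - s * y)))"
      by (auto intro!: continuous_intros continuous_on_compose2[OF assms(1)])
    show "norm ((1 - s) * (g (x + s * y) + g (x - s * y))) \<le> 2 * K" if "s \<in> {0..1}" for s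
    proof -
      have "\<bar>s * y\<bar> \<le> \<bar>y\<bar>"
        using that by (simp add: abs_mult mult_left_le_one_le)
      then have "\<bar>g (x + s * y)\<bar> \<le> K" "\<bar>g (x - s * y)\<bar> \<le> K"
        by (auto intro!: bound)
      then have "\<bar>g (x + s * y) + g (x - s * y)\<bar> \<le> 2 * K"
        by linarith
      moreover have "\<bar>1 - s\<bar> * \<bar>g (x + s * y) + g (x - s * y)\<bar> \<le> \<bar>g (x + s * y) + g (x - s * y)\<bar>"
        using that by (intro mult_left_le_one_le) auto
      ultimately show ?thesis
        by (simp add: abs_mult)
    qed
  qed simp
  then show ?thesis
    by (simp add: tent_mean_def)
qed

section \<open>The near part of the integral, \<open>0 < y \<le> 1\<close>\<close>

text \<open>For \<open>y > 0\<close> the quotient is the tent mean of \<open>u''\<close>, which is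
  continuous up to \<open>y = 0\<close>. This gives integrability, and closing the interval adds
  only a null set.\<close>

lemma second_diff_integral_near:
  assumes u: "\<And>x. (u has_real_derivative u' x) (at x)"
    and u': "\<And>x. (u' has_real_derivative u'' x) (at x)"
    and cont: "continuous_on UNIV u''"
  shows "set_integrable lborel {0<..1} (\<lambda>y. second_diff u x y / y\<^sup>2)"
    and "(LBINT y:{0<..1}. second_diff u x y / y\<^sup>2) = integral {0..1} (tent_mean u'' x)"
proof -
  have "continuous_on {0..1} (tent_mean u'' x)"
    by (rule continuous_on_tent_mean_right[OF cont])
  then have si: "set_integrable lborel {0..1} (tent_mean u'' x)"
    by (rule borel_integrable_atLeastAtMost')
  have si': "set_integrable lborel {0<..1} (tent_mean u'' x)"
    by (rule set_integrable_subset[OF si]) auto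
  have eq: "second_diff u x y / y\<^sup>2 = tent_mean u'' x y" if "y \<in> {0<..1}" for y
    using that second_diff_eq_tent_mean[OF u u', of x y] by simp
  show "set_integrable lborel {0<..1} (\<lambda>y. second_diff u x y / y\<^sup>2)"
    using si' by (rule set_integrable_cong[THEN iffD1, rotated -1]) (auto simp: eq)
  have "(LBINT y:{0<..1}. second_diff u x y / y\<^sup>2) = (LBINT y:{0<..1}. tent_mean u'' x y)"
    by (rule set_lebesgue_integral_cong) (auto simp: eq)
  also have "\<dots> = integral {0<..1} (tent_mean u'' x)"
    by (rule set_borel_integral_eq_integral(2)[OF si'])
  also have "\<dots> = integral {0..1} (tent_mean u'' x)"
    by (rule integral_spike_set; rule negligible_subset[of "{0}"]; auto)
  finally show "(LBINT y:{0<..1}. second_diff u x y / y\<^sup>2) = integral {0..1} (tent_mean u'' x)" .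
qed

text \<open>The near part is the derivative of \<open>H\<close>, the integral of the tent means of
  \<open>u'\<close>. Since \<open>H\<close> is at most \<open>2 * K\<close> in absolute value at
  \<open>x\<close> and \<open>x + 1\<close>, the mean value theorem on this unit interval gives
  \<open>4 * K\<close>.\<close>

lemma second_diff_integral_near_small:
  assumes u: "\<And>x. (u has_real_derivative u' x) (at x)"
    and u': "\<And>x. (u' has_real_derivative u'' x) (at x)"
    and cont: "continuous_on UNIV u''"
    and bound: "\<And>z. \<bar>z - x\<bar> \<le> 2 \<Longrightarrow> \<bar>u' z\<bar> \<le> K"
  shows "\<exists>t. x < t \<and> t < x + 1 \<and> \<bar>LBINT y:{0<..1}. second_diff u t y / y\<^sup>2\<bar> \<le> 4 * K"
proof -
  have u'_cont: "continuous_on UNIV u'"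
    using u' by (intro continuous_at_imp_continuous_on) (auto intro: DERIV_isCont)
  have tent_cont: "continuous_on {0..1} (tent_mean u' t)" for t
    by (rule continuous_on_tent_mean_right[OF u'_cont])
  define H where "H t = integral {0..1} (tent_mean u' t)" for t
  have H: "(H has_real_derivative integral {0..1} (tent_mean u'' t)) (at t)" for t
  proof -
    have "((\<lambda>t. integral (cbox 0 1) (tent_mean u' t)) has_real_derivative
        integral (cbox 0 1) (tent_mean u'' t)) (at t within UNIV)"
    proof (rule leibniz_rule_field_derivative)
      show "continuous_on (UNIV \<times> cbox 0 1) (\<lambda>(x, t). tent_mean u'' x t)"
        using continuous_on_tent_mean[OF cont] by (rule continuous_on_subset) auto
      show "tent_mean u' t integrable_on cbox 0 1" for t
        by (intro integrable_continuous) (simp add: tent_cont)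
    qed (auto intro: has_real_derivative_tent_mean[OF u' cont])
    then show ?thesis
      by (simp add: H_def[abs_def])
  qed
  have H_bound: "\<bar>H t\<bar> \<le> 2 * K" if "x \<le> t" "t \<le> x + 1" for t
  proof -
    have "norm (integral {0..1} (tent_mean u' t)) \<le> 2 * K * (1 - 0)"
    proof (rule integral_bound)
      \<comment> \<open>Only points within \<open>y \<le> 1\<close> of \<open>t\<close> enter, and
        \<open>t\<close> is within 1 of \<open>x\<close>; hence the radius 2 in
        \<open>bound\<close>.\<close>
      show "norm (tent_mean u' t y) \<le> 2 * K" if "y \<in> {0..1}" for y
        unfolding real_norm_def
        using that \<open>x \<le> t\<close> \<open>t \<le> x + 1\<close>
        by (intro abs_tent_mean_le[OF u'_cont] bound) auto
    qed (auto simp: tent_cont)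
    then show ?thesis
      by (simp add: H_def)
  qed
  obtain t where t: "x < t" "t < x + 1" "H (x + 1) - H x = (x + 1 - x) * integral {0..1} (tent_mean u'' t)"
    using MVT2[of x "x + 1" H, OF _ H] by auto
  have "\<bar>integral {0..1} (tent_mean u'' t)\<bar> \<le> 4 * K"
    using t(3) H_bound[of x] H_bound[of "x + 1"] by simp
  with t(1,2) show ?thesis
    by (auto simp: second_diff_integral_near(2)[OF u u' cont])
qed

section \<open>The far part of the integral, \<open>y > 1\<close>\<close>

text \<open>Serves both to dominate the far integrands and, through its value 1, to evaluate their
  limit as exactly \<open>l - r\<close>.\<close>

lemma has_bochner_integral_inverse_square_tail:
  "has_bochner_integral lborel (\<lambda>s::real. indicator {1<..} s * (1 / s\<^sup>2)) 1"
proof -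
  have "(\<integral>\<^sup>+s. ennreal (1 / s\<^sup>2) * indicator {1..} s \<partial>lborel) = ennreal (0 - (- 1 / 1 :: real))"
    by (rule nn_integral_FTC_atLeast[where F = "\<lambda>s. - 1 / s"], measurable)
       (real_asymp | auto intro!: derivative_eq_intros simp: power2_eq_square field_simps)+
  also have "(\<integral>\<^sup>+s. ennreal (1 / s\<^sup>2) * indicator {1..} s \<partial>lborel)
      = (\<integral>\<^sup>+s. ennreal (indicator {1<..} s * (1 / s\<^sup>2)) \<partial>lborel)"
    using AE_lborel_singleton[of "1::real"]
    by (intro nn_integral_cong_AE) (auto split: split_indicator)
  finally show ?thesis
    by (intro has_bochner_integral_nn_integral) auto
qed

lemma second_diff_integral_far:
  assumes meas: "u \<in> borel_measurable borel"
    and M: "\<And>x. \<bar>u x\<bar> \<le> M"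
  shows "set_integrable lborel {1<..} (\<lambda>y. second_diff u x y / y\<^sup>2)"
proof -
  note [measurable] = meas
  have M0: "M \<ge> 0"
    using M[of 0] by simp
  have "integrable lborel (\<lambda>s. 4 * M * (indicator {1<..} s * (1 / s\<^sup>2)))"
    using has_bochner_integral_inverse_square_tail
    by (intro integrable_mult_right) (auto simp: has_bochner_integral_iff)
  then have "integrable lborel (\<lambda>y. indicator {1<..} y *\<^sub>R (second_diff u x y / y\<^sup>2))"
  proof (rule Bochner_Integration.integrable_bound)
    have "\<bar>second_diff u x y\<bar> \<le> 4 * M" for y
      using M[of x] M[of "x + y"] M[of "x - y"] by (simp add: second_diff_def)
    then show "AE y in lborel. norm (indicator {1<..} y *\<^sub>R (second_diff u x y / y\<^sup>2))
        \<le> norm (4 * M * (indicator {1<..} y * (1 / y\<^sup>2)))"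
      using M0 by (auto split: split_indicator simp: divide_right_mono)
  qed (unfold second_diff_def, measurable)
  then show ?thesis
    by (simp add: set_integrable_def)
qed

text \<open>After \<open>y = t * s\<close>, the points \<open>t\<close> and \<open>t + t * s\<close>
  go to +infinity for \<open>s > 0\<close>, while \<open>t - t * s\<close> goes to +infinity for
  \<open>s < 1\<close> and to -infinity for \<open>s > 1\<close>. So the integrand tends to 0 for
  \<open>s < 1\<close> and to \<open>(l - r) / s\<^sup>2\<close> for \<open>s > 1\<close>, and
  dominated convergence applies.\<close>

lemma second_diff_integral_far_limit:
  assumes u: "\<And>x. (u has_real_derivative u' x) (at x)"
    and M: "\<And>x. \<bar>u x\<bar> \<le> M"
    and bound: "\<And>x. x \<ge> 1 \<Longrightarrow> \<bar>u' x\<bar> \<le> B / x\<^sup>2"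
    and l: "(u \<longlongrightarrow> l) at_bot" and r: "(u \<longlongrightarrow> r) at_top"
  shows "((\<lambda>t. t * (LBINT y:{1<..}. second_diff u t y / y\<^sup>2)) \<longlongrightarrow> l - r) at_top"
proof -
  have "continuous_on UNIV u"
    using u by (intro continuous_at_imp_continuous_on) (auto intro: DERIV_isCont)
  then have [measurable]: "u \<in> borel_measurable borel"
    by (rule borel_measurable_continuous_onI)
  have M0: "M \<ge> 0"
    using M[of 0] by simp
  have B0: "B \<ge> 0"
    using bound[of 1] by simp
  \<comment> \<open>The prefactor \<open>t\<close> and the Jacobian \<open>t\<close> cancel the
    \<open>t\<^sup>2\<close> in the denominator \<open>(t * s)\<^sup>2\<close>.\<close>
  define f where "f t s = indicator {1 / t<..} s * (second_diff u t (t * s) / s\<^sup>2)" for t s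
  \<comment> \<open>For small \<open>s\<close> the only bound is \<open>8 * B / (t * s)\<close>, but the cut-off at \<open>s > 1 / t\<close> makes it at most \<open>8 * B\<close>.\<close>
  define w where "w s = (8 * B + 16 * M) * (indicator {0..1} s + indicator {1<..} s * (1 / s\<^sup>2))" for s :: real
  have scale: "t * (LBINT y:{1<..}. second_diff u t y / y\<^sup>2) = (\<integral>s. f t s \<partial>lborel)" if "t > 0" for t
  proof -
    define h where "h s = indicator {1<..} (t * s) * (second_diff u t (t * s) / (t * s)\<^sup>2)" for s
    have f: "f t s = t\<^sup>2 * h s" for s
    proof -
      have "indicator {1<..} (t * s) = (indicator {1 / t<..} s :: real)"
        using that by (simp add: indicator_def pos_divide_less_eq mult.commute)
      then show ?thesis
        using that by (simp add: f_def h_def power_mult_distrib)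
    qed
    have "(LBINT y:{1<..}. second_diff u t y / y\<^sup>2) = t * (\<integral>s. h s \<partial>lborel)"
      unfolding set_lebesgue_integral_def h_def
      using that by (subst lborel_integral_real_affine[where c = t and t = 0]) auto
    then show ?thesis
      by (simp add: f power2_eq_square)
  qed
  \<comment> \<open>For \<open>s \<le> 1 / 2\<close> the three sample points lie in
    \<open>{t / 2..}\<close>, where \<open>\<bar>u'\<bar>\<close> is at most
    \<open>4 * B / t\<^sup>2\<close>; \<open>t \<ge> 2\<close> ensures \<open>t / 2 \<ge> 1\<close>,
    as \<open>bound\<close> requires.\<close>
  have small: "\<bar>second_diff u t (t * s)\<bar> \<le> 8 * B * s / t" if "t \<ge> 2" "0 < s" "s \<le> 1 / 2" for t s
  proof -
    have diff: "\<bar>u a - u t\<bar> \<le> 4 * B / t\<^sup>2 * (t * s)" if "\<bar>a - t\<bar> = t * s" for a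
    proof -
      have "t * s \<le> t * (1 / 2)"
        using \<open>t \<ge> 2\<close> \<open>s \<le> 1 / 2\<close> by (intro mult_left_mono) auto
      then have a: "t / 2 \<le> a"
        using that by linarith
      have "norm (u a - u t) \<le> 4 * B / t\<^sup>2 * norm (a - t)"
      proof (rule field_differentiable_bound[of "{t / 2..}"])
        show "norm (u' z) \<le> 4 * B / t\<^sup>2" if "z \<in> {t / 2..}" for z
        proof -
          have "\<bar>u' z\<bar> \<le> B / z\<^sup>2"
            using that \<open>t \<ge> 2\<close> by (intro bound) auto
          also have "\<dots> \<le> B / (t / 2)\<^sup>2"
            using that \<open>t \<ge> 2\<close> B0 by (intro divide_left_mono power_mono) auto
          finally show ?thesis
            by (simp add: power2_eq_square field_simps)
        qed
      qed (use \<open>t \<ge> 2\<close> a in \<open>auto intro: has_field_derivative_at_within[OF u]\<close>)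
      then show ?thesis
        using that by simp
    qed
    have "\<bar>second_diff u t (t * s)\<bar> \<le> \<bar>u (t + t * s) - u t\<bar> + \<bar>u (t - t * s) - u t\<bar>"
      unfolding second_diff_def by linarith
    also have "\<dots> \<le> 4 * B / t\<^sup>2 * (t * s) + 4 * B / t\<^sup>2 * (t * s)"
      using that by (intro add_mono diff) auto
    also have "\<dots> = 8 * B * s / t"
      using that by (simp add: power2_eq_square)
    finally show ?thesis .
  qed
  have dom: "\<bar>f t s\<bar> \<le> w s" if "t \<ge> 2" for t s
  proof (cases "s > 1 / t")
    case True
    have s0: "s > 0"
      using True that by (smt (verit) divide_pos_pos)
    have large: "\<bar>second_diff u t (t * s)\<bar> \<le> 4 * M"
      using M[of t] M[of "t + t * s"] M[of "t - t * s"] by (simp add: second_diff_def)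
    have f: "\<bar>f t s\<bar> = \<bar>second_diff u t (t * s)\<bar> / s\<^sup>2"
      using True by (simp add: f_def)
    \<comment> \<open>Near \<open>s = 1\<close> the point \<open>t - t * s\<close> need not be
      large, so derivative decay is used only up to 1/2. Beyond,
      \<open>\<bar>u\<bar> \<le> M\<close> suffices; \<open>16 * M\<close> is
      \<open>4 * M / (1 / 2)\<^sup>2\<close>.\<close>
    consider "s \<le> 1 / 2" | "1 / 2 < s" "s \<le> 1" | "s > 1" by linarith
    then show ?thesis
    proof cases
      case 1
      have "\<bar>f t s\<bar> \<le> (8 * B * s / t) / s\<^sup>2"
        unfolding f using small[OF that s0 1] by (intro divide_right_mono) auto
      also have "\<dots> = 8 * B * (1 / (t * s))"
        using s0 that by (simp add: power2_eq_square)
      also have "\<dots> \<le> 8 * B * 1"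
        using True B0 that s0 by (intro mult_left_mono) (auto simp: field_simps)
      finally show ?thesis
        using 1 s0 M0 by (simp add: w_def)
    next
      case 2
      have "\<bar>f t s\<bar> \<le> 4 * M / (1 / 2)\<^sup>2"
        unfolding f using large 2 M0 by (intro frac_le power_mono) auto
      then show ?thesis
        using 2 B0 by (simp add: w_def power2_eq_square)
    next
      case 3
      have "\<bar>f t s\<bar> \<le> (8 * B + 16 * M) / s\<^sup>2"
        unfolding f using large B0 M0 by (intro divide_right_mono) auto
      then show ?thesis
        using 3 by (simp add: w_def)
    qed
  next
    case False
    then show ?thesis
      using B0 M0 by (auto simp: f_def w_def split: split_indicator)
  qed
  \<comment> \<open>At \<open>s = 1\<close> the point \<open>t - t * s\<close> stays at 0, so the
    limit would involve \<open>u 0\<close>; a single point is negligible.\<close>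
  have lim: "((\<lambda>t. f t s) \<longlongrightarrow> (l - r) * (indicator {1<..} s * (1 / s\<^sup>2))) at_top" if "s \<noteq> 1" for s
  proof (cases "s > 0")
    case True
    have ev: "eventually (\<lambda>t. second_diff u t (t * s) / s\<^sup>2 = f t s) at_top"
      using eventually_gt_at_top[of "1 / s"] 
    proof eventually_elim
      case (elim t)
      then have "t > 0"
        using True by (smt (verit) divide_pos_pos)
      then have "1 / t < s"
        using elim True by (simp add: field_simps)
      then show ?case
        by (simp add: f_def)
    qed
    have plus: "((\<lambda>t. u (t + t * s)) \<longlongrightarrow> r) at_top"
      by (rule filterlim_compose[OF r]) (use True in real_asymp)
    have minus: "((\<lambda>t. u (t - t * s)) \<longlongrightarrow> (if s < 1 then r else l)) at_top"
    proof (cases "s < 1")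
      case True
      have "((\<lambda>t. u (t - t * s)) \<longlongrightarrow> r) at_top"
        by (rule filterlim_compose[OF r]) (use True in real_asymp)
      with True show ?thesis by simp
    next
      case False
      with \<open>s \<noteq> 1\<close> have "s > 1" by simp
      then have "((\<lambda>t. u (t - t * s)) \<longlongrightarrow> l) at_top"
        by (intro filterlim_compose[OF l]) real_asymp
      with False show ?thesis by simp
    qed
    have "((\<lambda>t. second_diff u t (t * s) / s\<^sup>2) \<longlongrightarrow>
        (r - 2 * r + (if s < 1 then r else l)) / s\<^sup>2) at_top"
      unfolding second_diff_def using True by (intro tendsto_intros plus minus r) auto
    also have "(r - 2 * r + (if s < 1 then r else l)) / s\<^sup>2 = (l - r) * (indicator {1<..} s * (1 / s\<^sup>2))"
      using that by auto
    finally show ?thesis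
      using ev by (rule Lim_transform_eventually)
  next
    case False
    have "eventually (\<lambda>t. 0 = f t s) at_top"
      using eventually_gt_at_top[of 0]
    proof eventually_elim
      case (elim t)
      then have "\<not> 1 / t < s"
        using False by (smt (verit) divide_pos_pos)
      then show ?case
        by (simp add: f_def)
    qed
    then have "((\<lambda>t. f t s) \<longlongrightarrow> 0) at_top"
      by (rule Lim_transform_eventually[OF tendsto_const])
    then show ?thesis
      using False by simp
  qed
  have "((\<lambda>t. \<integral>s. f t s \<partial>lborel) \<longlongrightarrow> (\<integral>s. (l - r) * (indicator {1<..} s * (1 / s\<^sup>2)) \<partial>lborel)) at_top"
  proof (rule integral_dominated_convergence_at_top[where w = w])
    show "integrable lborel w"
      unfolding w_def using has_bochner_integral_inverse_square_tail
      by (intro integrable_mult_right Bochner_Integration.integrable_add)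
         (auto simp: has_bochner_integral_iff)
    show "\<forall>\<^sub>F t in at_top. AE s in lborel. norm (f t s) \<le> w s"
      using eventually_ge_at_top[of 2] by eventually_elim (auto simp: dom)
    show "AE s in lborel. ((\<lambda>t. f t s) \<longlongrightarrow> (l - r) * (indicator {1<..} s * (1 / s\<^sup>2))) at_top"
      using AE_lborel_singleton[of "1::real"] by eventually_elim (rule lim)
  qed (unfold f_def second_diff_def, measurable)
  also have "(\<integral>s. (l - r) * (indicator {1<..} s * (1 / s\<^sup>2)) \<partial>lborel) = l - r"
    unfolding integral_mult_right_zero
      has_bochner_integral_integral_eq[OF has_bochner_integral_inverse_square_tail]
    by simp
  finally show ?thesis
    by (rule Lim_transform_eventually)
       (use eventually_gt_at_top[of 0] in \<open>eventually_elim, simp add: scale\<close>)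
qed

section \<open>Asymptotics at +infinity\<close>

lemma half_laplacian_near_far:
  assumes u: "\<And>x. (u has_real_derivative u' x) (at x)"
    and u': "\<And>x. (u' has_real_derivative u'' x) (at x)"
    and cont: "continuous_on UNIV u''"
    and M: "\<And>x. \<bar>u x\<bar> \<le> M"
  shows "half_laplacian u x = - (1 / pi) * ((LBINT y:{0<..1}. second_diff u x y / y\<^sup>2)
      + (LBINT y:{1<..}. second_diff u x y / y\<^sup>2))"
proof -
  have "continuous_on UNIV u"
    using u by (intro continuous_at_imp_continuous_on) (auto intro: DERIV_isCont)
  then have "u \<in> borel_measurable borel"
    by (rule borel_measurable_continuous_onI)
  moreover have "{0<..} = {0<..1} \<union> {1::real<..}" by auto
  ultimately show ?thesis
    unfolding half_laplacian_def second_diff_def[symmetric]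
    using set_integral_Un[OF _ second_diff_integral_near(1)[OF u u' cont, where x = x]
        second_diff_integral_far[OF _ M, where x = x]]
    by (simp add: disjoint_iff)
qed

text \<open>Phrased for a general nonlinearity \<open>f\<close> in place of the derivative of
  \<open>F\<close>, and without fixing the order of \<open>l\<close> and \<open>r\<close>, so that
  it covers both the profile and its reflection.\<close>

lemma tail_asymptotics:
  fixes u u' u'' f :: "real \<Rightarrow> real"
  assumes u: "\<And>x. (u has_real_derivative u' x) (at x)"
    and u': "\<And>x. (u' has_real_derivative u'' x) (at x)"
    and cont: "continuous_on UNIV u''"
    and M: "\<And>x. \<bar>u x\<bar> \<le> M"
    and bound: "\<And>x. x \<ge> 1 \<Longrightarrow> \<bar>u' x\<bar> \<le> B / x\<^sup>2"
    and l: "(u \<longlongrightarrow> l) at_bot" and r: "(u \<longlongrightarrow> r) at_top"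
    and eq: "\<And>x. - half_laplacian u x + c * u' x = f (u x)"
    and f: "f r = 0" "(f has_real_derivative m) (at r)" "m \<noteq> 0"
  shows "((\<lambda>x. x * (u x - r)) \<longlongrightarrow> (l - r) / (pi * m)) at_top"
proof -
  define J where "J t = (LBINT y:{0<..1}. second_diff u t y / y\<^sup>2)" for t
  define E where "E t = (LBINT y:{1<..}. second_diff u t y / y\<^sup>2)" for t
  have B0: "B \<ge> 0"
    using bound[of 1] by simp
  have bound': "\<bar>u' z\<bar> \<le> B / a\<^sup>2" if "1 \<le> a" "a \<le> z" for a z
  proof -
    have "\<bar>u' z\<bar> \<le> B / z\<^sup>2"
      using that by (intro bound) auto
    also have "\<dots> \<le> B / a\<^sup>2"
      using that B0 by (intro divide_left_mono power_mono) auto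
    finally show ?thesis .
  qed
  \<comment> \<open>The near-part estimate needs a bound for \<open>u'\<close> on the interval of
    radius 2 around \<open>x\<close>, whose left end \<open>x - 2\<close> is at least 1 when
    \<open>x \<ge> 3\<close>.\<close>
  have "\<exists>t. x < t \<and> t < x + 1 \<and> \<bar>J t\<bar> \<le> 4 * (B / (x - 2)\<^sup>2)" if "x \<ge> 3" for x
    unfolding J_def using that
    by (intro second_diff_integral_near_small[OF u u' cont] bound') auto
  then obtain t where t: "\<And>x. x \<ge> 3 \<Longrightarrow> x < t x \<and> t x < x + 1 \<and> \<bar>J (t x)\<bar> \<le> 4 * (B / (x - 2)\<^sup>2)"
    by metis
  have ge3: "eventually (\<lambda>x::real. x \<ge> 3) at_top"
    by (rule eventually_ge_at_top)
  have t_top: "filterlim t at_top at_top"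
    by (rule filterlim_at_top_mono[OF filterlim_ident])
       (use ge3 in \<open>eventually_elim, use t in force\<close>)
  have ratio: "((\<lambda>x. x / t x) \<longlongrightarrow> 1) at_top"
  proof (rule tendsto_sandwich)
    show "\<forall>\<^sub>F x in at_top. x / (x + 1) \<le> x / t x"
      using ge3 by eventually_elim (use t in \<open>force intro!: divide_left_mono\<close>)
    show "\<forall>\<^sub>F x in at_top. x / t x \<le> 1"
      using ge3 by eventually_elim (use t in force)
  qed real_asymp+
  have J: "((\<lambda>x. t x * J (t x)) \<longlongrightarrow> 0) at_top"
  proof (rule Lim_null_comparison)
    show "\<forall>\<^sub>F x in at_top. norm (t x * J (t x)) \<le> (x + 1) * (4 * (B / (x - 2)\<^sup>2))"
      using ge3
    proof eventually_elim
      case (elim x)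
      have "\<bar>t x\<bar> * \<bar>J (t x)\<bar> \<le> (x + 1) * (4 * (B / (x - 2)\<^sup>2))"
        using t[OF elim] elim by (intro mult_mono) auto
      then show ?case
        by (simp add: abs_mult)
    qed
  qed real_asymp
  have D: "((\<lambda>x. t x * u' (t x)) \<longlongrightarrow> 0) at_top"
  proof (rule Lim_null_comparison)
    show "\<forall>\<^sub>F x in at_top. norm (t x * u' (t x)) \<le> (x + 1) * (B / x\<^sup>2)"
      using ge3
    proof eventually_elim
      case (elim x)
      have "\<bar>t x\<bar> * \<bar>u' (t x)\<bar> \<le> (x + 1) * (B / x\<^sup>2)"
        using t[OF elim] elim by (intro mult_mono bound') auto
      then show ?case
        by (simp add: abs_mult)
    qed
  qed real_asymp
  have E: "((\<lambda>x. t x * E (t x)) \<longlongrightarrow> l - r) at_top"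
    unfolding E_def
    by (rule filterlim_compose[OF second_diff_integral_far_limit[OF u M bound l r] t_top])
  \<comment> \<open>The equation at \<open>t x\<close>, multiplied by \<open>t x\<close>: only the
    far part survives in the limit.\<close>
  have "((\<lambda>x. (1 / pi) * (t x * J (t x) + t x * E (t x)) + c * (t x * u' (t x)))
      \<longlongrightarrow> (1 / pi) * (0 + (l - r)) + c * 0) at_top"
    by (intro tendsto_intros J D E)
  also have "(\<lambda>x. (1 / pi) * (t x * J (t x) + t x * E (t x)) + c * (t x * u' (t x)))
      = (\<lambda>x. t x * f (u (t x)))"
    unfolding eq[symmetric] half_laplacian_near_far[OF u u' cont M] J_def E_def
    by (simp add: algebra_simps add_divide_distrib)
  finally have F: "((\<lambda>x. t x * f (u (t x))) \<longlongrightarrow> (l - r) / pi) at_top"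
    by simp
  \<comment> \<open>Caratheodory's form of differentiability linearises \<open>f\<close> at
    \<open>r\<close> without a remainder term, so \<open>u (t x) - r\<close> is recovered by
    dividing by \<open>g (u (t x))\<close>, which tends to \<open>m \<noteq> 0\<close>.\<close>
  obtain g where g: "\<And>z. f z = g z * (z - r)" "isCont g r" "g r = m"
    using f(1,2) unfolding CARAT_DERIV by auto
  have ut: "((\<lambda>x. u (t x)) \<longlongrightarrow> r) at_top"
    by (rule filterlim_compose[OF r t_top])
  have gt: "((\<lambda>x. g (u (t x))) \<longlongrightarrow> m) at_top"
    using isCont_tendsto_compose[OF g(2) ut] g(3) by simp
  have "((\<lambda>x. t x * f (u (t x)) / g (u (t x))) \<longlongrightarrow> (l - r) / pi / m) at_top"
    by (intro tendsto_divide F gt f(3))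
  moreover have "\<forall>\<^sub>F x in at_top. t x * f (u (t x)) / g (u (t x)) = t x * (u (t x) - r)"
    using tendsto_imp_eventually_ne[OF gt f(3)] by eventually_elim (simp add: g(1))
  ultimately have T: "((\<lambda>x. t x * (u (t x) - r)) \<longlongrightarrow> (l - r) / pi / m) at_top"
    by (rule Lim_transform_eventually)
  have shift: "((\<lambda>x. x * (u (t x) - u x)) \<longlongrightarrow> 0) at_top"
  proof (rule Lim_null_comparison)
    show "\<forall>\<^sub>F x in at_top. norm (x * (u (t x) - u x)) \<le> x * (B / x\<^sup>2)"
      using ge3
    proof eventually_elim
      case (elim x)
      have tx: "x < t x" "t x < x + 1" using t[OF elim] by auto
      have "norm (u (t x) - u x) \<le> B / x\<^sup>2 * norm (t x - x)"
        by (rule field_differentiable_bound[of "{x..}"])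
           (use elim tx in \<open>auto intro: has_field_derivative_at_within[OF u] bound'\<close>)
      also have "\<dots> \<le> B / x\<^sup>2 * 1"
        using tx B0 by (intro mult_left_mono) auto
      finally have "x * \<bar>u (t x) - u x\<bar> \<le> x * (B / x\<^sup>2)"
        using elim by (intro mult_left_mono) auto
      then show ?case
        using elim by (simp add: abs_mult)
    qed
  qed real_asymp
  \<comment> \<open>Passing from \<open>t x\<close> back to \<open>x\<close> changes the prefactor
    by a ratio tending to 1 and the value of \<open>u\<close> by
    \<open>O(1/x\<^sup>2)\<close>.\<close>
  have "((\<lambda>x. x / t x * (t x * (u (t x) - r)) - x * (u (t x) - u x))
      \<longlongrightarrow> 1 * ((l - r) / pi / m) - 0) at_top"
    by (intro tendsto_intros ratio T shift)
  moreover have "\<forall>\<^sub>F x in at_top. x / t x * (t x * (u (t x) - r)) - x * (u (t x) - u x) = x * (u x - r)"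
    using ge3
  proof eventually_elim
    case (elim x)
    then have "t x \<noteq> 0" using t[OF elim] by auto
    then show ?case by (simp add: algebra_simps)
  qed
  ultimately show ?thesis
    by (auto dest: Lim_transform_eventually)
qed

section \<open>Asymptotic equivalence, and reflection to -infinity\<close>

lemma asymp_equiv_inverseI:
  fixes g :: "real \<Rightarrow> real"
  assumes "((\<lambda>x. x * g x) \<longlongrightarrow> L) F" "L \<noteq> 0" "\<forall>\<^sub>F x in F. x \<noteq> 0"
  shows "g \<sim>[F] (\<lambda>x. L * x powi (-1))"
proof (rule asymp_equivI')
  have "((\<lambda>x. x * g x / L) \<longlongrightarrow> L / L) F"
    by (intro tendsto_intros assms)
  moreover have "\<forall>\<^sub>F x in F. x * g x / L = g x / (L * x powi (-1))"
    using assms(3) by eventually_elim (use assms(2) in \<open>simp add: power_int_minus field_simps\<close>)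
  ultimately show "((\<lambda>x. g x / (L * x powi (-1))) \<longlongrightarrow> 1) F"
    using assms(2) by (auto dest: Lim_transform_eventually)
qed

lemma C_k_real_has_derivative:
  assumes "C_k_real k f" "i < k"
  shows "((deriv ^^ i) f has_real_derivative (deriv ^^ Suc i) f x) (at x)"
  using assms by (auto simp: C_k_real_def real_differentiable_def dest: DERIV_imp_deriv)

text \<open>Reflection exchanges the points \<open>x + y\<close> and \<open>x - y\<close>, which
  enter symmetrically; only the outer sign remains.\<close>

lemma half_laplacian_reflect: "half_laplacian (\<lambda>x. - u (- x)) x = - half_laplacian u (- x)"
proof -
  have "(- u (- (x + y)) - 2 * - u (- x) + - u (- (x - y))) / y\<^sup>2
      = - ((u (- x + y) - 2 * u (- x) + u (- x - y)) / y\<^sup>2)" for y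
  proof -
    have "- (x + y) = - x - y" "- (x - y) = - x + y"
      by simp_all
    moreover have "(- a - 2 * - b + - d) / e = - ((d - 2 * b + a) / e)" for a b d e :: real
      by (simp add: minus_divide_left)
    ultimately show ?thesis
      by (simp only:)
  qed
  then show ?thesis
    by (simp add: half_laplacian_def set_lebesgue_integral_def)
qed

theorem proposition1p1:
  fixes \<eta>\<^sub>l \<eta>\<^sub>r c A B :: real
    and F \<eta> :: "real \<Rightarrow> real"
  assumes "\<eta>\<^sub>l < \<eta>\<^sub>r"
    and "C_k_real 3 F"
    and "deriv F \<eta>\<^sub>l = 0" and "deriv F \<eta>\<^sub>r = 0"
    and "deriv (deriv F) \<eta>\<^sub>l > 0" and "deriv (deriv F) \<eta>\<^sub>r > 0"
    and "C_k_real 2 \<eta>"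
    and "mono \<eta>"
    and "\<And>x. deriv \<eta> x > 0"
    and "\<And>x. - half_laplacian \<eta> x + c * deriv \<eta> x = deriv F (\<eta> x)"
    and "(\<eta> \<longlongrightarrow> \<eta>\<^sub>l) at_bot"
    and "(\<eta> \<longlongrightarrow> \<eta>\<^sub>r) at_top"
    and "0 < A" and "A < B"
    and "\<And>x. \<bar>x\<bar> \<ge> 1 \<Longrightarrow>
           A * \<bar>x\<bar> powi (-2) \<le> deriv \<eta> x \<and> deriv \<eta> x \<le> B * \<bar>x\<bar> powi (-2)"
  shows "((\<lambda>x. \<eta> x - \<eta>\<^sub>r) \<sim>[at_top]
            (\<lambda>x. (\<eta>\<^sub>l - \<eta>\<^sub>r) / (pi * deriv (deriv F) \<eta>\<^sub>r) * x powi (-1)))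
       \<and> ((\<lambda>x. \<eta> x - \<eta>\<^sub>l) \<sim>[at_bot]
            (\<lambda>x. (\<eta>\<^sub>l - \<eta>\<^sub>r) / (pi * deriv (deriv F) \<eta>\<^sub>l) * x powi (-1)))"
proof -
  have F: "(deriv F has_real_derivative deriv (deriv F) x) (at x)" for x
    using C_k_real_has_derivative[OF assms(2), of 1] by simp
  have \<eta>: "(\<eta> has_real_derivative deriv \<eta> x) (at x)"
    "(deriv \<eta> has_real_derivative deriv (deriv \<eta>) x) (at x)" for x
    using C_k_real_has_derivative[OF assms(7), of 0] C_k_real_has_derivative[OF assms(7), of 1] by simp_all
  have cont: "continuous_on UNIV (deriv (deriv \<eta>))"
  proof -
    have "(deriv ^^ 2) \<eta> = deriv (deriv \<eta>)"
      by (simp only: numeral_2_eq_2 funpow.simps comp_apply id_apply)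
    then show ?thesis
      using assms(7) by (simp only: C_k_real_def)
  qed
  have bounds: "\<eta>\<^sub>l \<le> \<eta> x" "\<eta> x \<le> \<eta>\<^sub>r" for x
  proof -
    have "\<forall>\<^sub>F y in at_bot. \<eta> y \<le> \<eta> x"
      using eventually_le_at_bot[of x] by eventually_elim (rule monoD[OF assms(8)])
    then show "\<eta>\<^sub>l \<le> \<eta> x"
      by (rule tendsto_upperbound[OF assms(11)]) simp
    have "\<forall>\<^sub>F y in at_top. \<eta> x \<le> \<eta> y"
      using eventually_ge_at_top[of x] by eventually_elim (rule monoD[OF assms(8)])
    then show "\<eta> x \<le> \<eta>\<^sub>r"
      by (rule tendsto_lowerbound[OF assms(12)]) simp
  qed
  define M where "M = \<bar>\<eta>\<^sub>l\<bar> + \<bar>\<eta>\<^sub>r\<bar>"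
  have M: "\<bar>\<eta> x\<bar> \<le> M" for x
    using bounds[of x] by (simp add: M_def)
  have decay: "\<bar>deriv \<eta> x\<bar> \<le> B / x\<^sup>2" if "\<bar>x\<bar> \<ge> 1" for x
    using assms(15)[OF that] assms(9)[of x] by (simp add: power_int_minus divide_inverse)
  have "((\<lambda>x. x * (\<eta> x - \<eta>\<^sub>r)) \<longlongrightarrow> (\<eta>\<^sub>l - \<eta>\<^sub>r) / (pi * deriv (deriv F) \<eta>\<^sub>r)) at_top"
    by (rule tail_asymptotics[OF \<eta> cont M decay assms(11,12,10,4) F]) (use assms(6) in auto)
  then have 1: "(\<lambda>x. \<eta> x - \<eta>\<^sub>r) \<sim>[at_top]
      (\<lambda>x. (\<eta>\<^sub>l - \<eta>\<^sub>r) / (pi * deriv (deriv F) \<eta>\<^sub>r) * x powi (-1))"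
    by (rule asymp_equiv_inverseI) (use assms(1,6) in \<open>auto intro: eventually_mono[OF eventually_gt_at_top[of 0]]\<close>)
  \<comment> \<open>The reflected profile increases from \<open>- \<eta>\<^sub>r\<close> to
    \<open>- \<eta>\<^sub>l\<close> and solves the equation with speed \<open>- c\<close> and
    nonlinearity \<open>- deriv F (- z)\<close>. The two signs cancel on differentiation, so the
    slope at \<open>- \<eta>\<^sub>l\<close> is
    \<open>deriv (deriv F) \<eta>\<^sub>l\<close>.\<close>
  have "((\<lambda>x. x * (- \<eta> (- x) - - \<eta>\<^sub>l)) \<longlongrightarrow> (- \<eta>\<^sub>r - - \<eta>\<^sub>l) / (pi * deriv (deriv F) \<eta>\<^sub>l)) at_top"
  proof (rule tail_asymptotics[where M = M and B = B and c = "- c" and f = "\<lambda>z. - deriv F (- z)"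
        and u' = "\<lambda>x. deriv \<eta> (- x)" and u'' = "\<lambda>x. - deriv (deriv \<eta>) (- x)"])
    show "((\<lambda>x. - \<eta> (- x)) has_real_derivative deriv \<eta> (- x)) (at x)" for x
      by (auto intro!: derivative_eq_intros DERIV_chain'[OF _ \<eta>(1)])
    show "((\<lambda>x. deriv \<eta> (- x)) has_real_derivative - deriv (deriv \<eta>) (- x)) (at x)" for x
      using DERIV_chain'[OF DERIV_minus[OF DERIV_ident] \<eta>(2), of x UNIV] by simp
    show "continuous_on UNIV (\<lambda>x. - deriv (deriv \<eta>) (- x))"
      by (auto intro!: continuous_intros continuous_on_compose2[OF cont])
    show "((\<lambda>x. - \<eta> (- x)) \<longlongrightarrow> - \<eta>\<^sub>r) at_bot"
      by (intro tendsto_intros filterlim_compose[OF assms(12)] filterlim_uminus_at_top_at_bot)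
    show "((\<lambda>x. - \<eta> (- x)) \<longlongrightarrow> - \<eta>\<^sub>l) at_top"
      by (intro tendsto_intros filterlim_compose[OF assms(11)] filterlim_uminus_at_bot_at_top)
    show "- half_laplacian (\<lambda>x. - \<eta> (- x)) x + - c * deriv \<eta> (- x) = - deriv F (- (- \<eta> (- x)))" for x
      using assms(10)[of "- x"] by (simp add: half_laplacian_reflect)
    show "((\<lambda>z. - deriv F (- z)) has_real_derivative deriv (deriv F) \<eta>\<^sub>l) (at (- \<eta>\<^sub>l))"
      by (auto intro!: derivative_eq_intros DERIV_chain'[OF _ F])
    show "\<bar>deriv \<eta> (- x)\<bar> \<le> B / x\<^sup>2" if "1 \<le> x" for x
      using decay[of "- x"] that by simp
  qed (use M assms(3,5) in auto)
  then have "((\<lambda>x. - x * (- \<eta> (- (- x)) - - \<eta>\<^sub>l)) \<longlongrightarrow> (- \<eta>\<^sub>r - - \<eta>\<^sub>l) / (pi * deriv (deriv F) \<eta>\<^sub>l)) at_bot"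
    by (rule filterlim_compose[OF _ filterlim_uminus_at_top_at_bot])
  \<comment> \<open>The signs from the reflected variable and the reflected value cancel in the
    product, and \<open>- \<eta>\<^sub>r - - \<eta>\<^sub>l\<close> is again
    \<open>\<eta>\<^sub>l - \<eta>\<^sub>r\<close>; hence the same numerator at both ends.\<close>
  then have "((\<lambda>x. x * (\<eta> x - \<eta>\<^sub>l)) \<longlongrightarrow> (\<eta>\<^sub>l - \<eta>\<^sub>r) / (pi * deriv (deriv F) \<eta>\<^sub>l)) at_bot"
    by (simp add: algebra_simps)
  then have 2: "(\<lambda>x. \<eta> x - \<eta>\<^sub>l) \<sim>[at_bot]
      (\<lambda>x. (\<eta>\<^sub>l - \<eta>\<^sub>r) / (pi * deriv (deriv F) \<eta>\<^sub>l) * x powi (-1))"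
    by (rule asymp_equiv_inverseI) (use assms(1,5) in \<open>auto intro: eventually_mono[OF eventually_gt_at_bot[of 0]]\<close>)
  from 1 2 show ?thesis ..
qed

end
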